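(* Let $f$ be any function with property $P^{\ast}$ and let $n\geq 6$. Among all bicyclic graphs of order $n$, $B_1$ is the unique graph with the largest value of $\rho(A_f(\cdot))$; i.e. $\rho(A_f(G))<\rho(A_f(B_1))$ for every bicyclic graph $G\not\cong B_1$ of order $n$.
   Context: All graphs are simple and connected; $d_i$ is the degree of $v_i$. A function $f(x,y)$ (positive, symmetric, twice differentiable in $x$) has property $P^{\ast}$ if $f>0$, $f'_x\geq 0$, $f''_x\geq 0$, and whenever $x_1+y_1=x_2+y_2$ and $|x_1-y_1|>|x_2-y_2|$ we have $f(x_1,y_1)\geq f(x_2,y_2)$. $A_f(G)$ has $(i,j)$-entry $f(d_i,d_j)$ if $v_iv_j\in E(G)$ and $0$ otherwise; $\rho(A_f(G))$ is its largest eigenvalue. A bicyclic graph is a connected graph with $|E|=|V|+1$. $B_1$ is the graph of order $n$ obtained from $K_4$ minus an edge (the diamond) by attaching $n-4$ pendant vertices to one of its two degree-3 vertices (equivalently, the star $S_n$ with two edges added between leaves sharing a common leaf). *)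

theory Defs
  imports "HOL-Analysis.Analysis" "Jordan_Normal_Form.Char_Poly"
begin

definition simple_graph :: "nat \<Rightarrow> (nat \<Rightarrow> nat \<Rightarrow> bool) \<Rightarrow> bool" where
  "simple_graph n E \<longleftrightarrow> (\<forall>i j. E i j \<longrightarrow> i < n \<and> j < n) \<and>
     (\<forall>i j. E i j \<longrightarrow> E j i) \<and> (\<forall>i. \<not> E i i)"

definition connected_graph :: "nat \<Rightarrow> (nat \<Rightarrow> nat \<Rightarrow> bool) \<Rightarrow> bool" where
  "connected_graph n E \<longleftrightarrow> (\<forall>i<n. \<forall>j<n. E\<^sup>*\<^sup>* i j)"

definition num_edges :: "nat \<Rightarrow> (nat \<Rightarrow> nat \<Rightarrow> bool) \<Rightarrow> nat" where
  "num_edges n E = card {(i, j). i < j \<and> j < n \<and> E i j}"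

definition bicyclic :: "nat \<Rightarrow> (nat \<Rightarrow> nat \<Rightarrow> bool) \<Rightarrow> bool" where
  "bicyclic n E \<longleftrightarrow> simple_graph n E \<and> connected_graph n E \<and> num_edges n E = n + 1"

definition degree :: "nat \<Rightarrow> (nat \<Rightarrow> nat \<Rightarrow> bool) \<Rightarrow> nat \<Rightarrow> nat" where
  "degree n E i = card {j. j < n \<and> E i j}"

definition graph_iso :: "nat \<Rightarrow> (nat \<Rightarrow> nat \<Rightarrow> bool) \<Rightarrow> (nat \<Rightarrow> nat \<Rightarrow> bool) \<Rightarrow> bool" where
  "graph_iso n E F \<longleftrightarrow> (\<exists>p. bij_betw p {0..<n} {0..<n} \<and>
     (\<forall>i<n. \<forall>j<n. E i j \<longleftrightarrow> F (p i) (p j)))"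

text \<open>B_1: star centred at 0 with leaves 1..n-1, plus the edges 1-2 and 1-3.
  Equivalently the diamond on {0,1,2,3} (missing edge 2-3) with n-4 pendant
  vertices attached to the degree-3 vertex 0.\<close>
definition B1 :: "nat \<Rightarrow> nat \<Rightarrow> nat \<Rightarrow> bool" where
  "B1 n i j \<longleftrightarrow> i < n \<and> j < n \<and>
     ((i = 0 \<and> j \<noteq> 0) \<or> (j = 0 \<and> i \<noteq> 0) \<or>
      (i = 1 \<and> (j = 2 \<or> j = 3)) \<or> (j = 1 \<and> (i = 2 \<or> i = 3)))"

definition A_f :: "(real \<Rightarrow> real \<Rightarrow> real) \<Rightarrow> nat \<Rightarrow> (nat \<Rightarrow> nat \<Rightarrow> bool) \<Rightarrow> real mat" where
  "A_f f n E = mat n n (\<lambda>(i, j). if E i j then f (real (degree n E i)) (real (degree n E j)) else 0)"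

definition rho :: "real mat \<Rightarrow> real" where
  "rho A = Max {k. eigenvalue A k}"

text \<open>Property P*, on the domain of positive reals (degrees are positive).\<close>
definition property_P_star :: "(real \<Rightarrow> real \<Rightarrow> real) \<Rightarrow> bool" where
  "property_P_star f \<longleftrightarrow>
     (\<forall>x y. f x y = f y x) \<and>
     (\<forall>x>0. \<forall>y>0. f x y > 0) \<and>
     (\<exists>fx fxx. \<forall>x>0. \<forall>y>0.
        ((\<lambda>t. f t y) has_real_derivative fx x y) (at x) \<and>
        ((\<lambda>t. fx t y) has_real_derivative fxx x y) (at x) \<and>
        fx x y \<ge> 0 \<and> fxx x y \<ge> 0) \<and>
     (\<forall>x1 y1 x2 y2. x1 > 0 \<longrightarrow> y1 > 0 \<longrightarrow> x2 > 0 \<longrightarrow> y2 > 0 \<longrightarrow>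
        x1 + y1 = x2 + y2 \<longrightarrow> \<bar>x1 - y1\<bar> > \<bar>x2 - y2\<bar> \<longrightarrow> f x1 y1 \<ge> f x2 y2)"

end

(* For vertices u, v move all private neighbours of v to u (Kelmans transformation). If x is the
   Perron vector and x u >= x v, then monotonicity, convexity and the spreading property of f show
   that the quadratic form of A_f does not decrease at x, and it increases row u strictly, so the
   largest eigenvalue increases strictly. The transformation keeps a graph connected when u, v are
   adjacent or have a common neighbour. Hence in a maximiser any such u, v have nested
   neighbourhoods, which forces a dominating vertex, and the two edges that avoid this vertex must
   share an endpoint: the maximiser is B1. *)
theory Submission
  imports Defs
begin

subsection \<open>Rayleigh quotients of symmetric matrices\<close>

text \<open>The obstacle is strictness. The form at the Perron vector may stay equal: for constant f
  and \<open>x u = x v\<close> moving an edge from v to u costs exactly what it gains. So strict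
  growth is taken from the eigenvector equation, not from the form. Both private neighbourhoods must
  be nonempty. If v has no private neighbour nothing moves, and if u has none the result is the old
  graph with u and v exchanged. Adjacency or a common neighbour does double duty: it keeps the graph
  connected, and it leaves v a positive degree, so that f is still evaluated where property P*
  speaks. No chain of transformations from a given graph to B_1 has to be followed. There are
  finitely many bicyclic graphs on the vertices below n, so a maximiser exists, and it admits no
  improving step. A dominating vertex uses up n - 1 of the n + 1 edges, which is where the two
  remaining edges come from.\<close>

definition quad_form :: "nat \<Rightarrow> (nat \<Rightarrow> nat \<Rightarrow> real) \<Rightarrow> (nat \<Rightarrow> real) \<Rightarrow> real" where
  "quad_form n a x = (\<Sum>i<n. \<Sum>j<n. a i j * x i * x j)"

lemma quad_form_eq: "quad_form n a x = (\<Sum>i<n. x i * (\<Sum>j<n. a i j * x j))"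
  unfolding quad_form_def by (simp add: sum_distrib_left mult_ac)

lemma eigenvalue_mat_iff:
  fixes a :: "nat \<Rightarrow> nat \<Rightarrow> real"
  shows "eigenvalue (mat n n (\<lambda>(i, j). a i j)) k \<longleftrightarrow>
    (\<exists>x. (\<exists>i<n. x i \<noteq> 0) \<and> (\<forall>i<n. (\<Sum>j<n. a i j * x j) = k * x i))"
    (is "eigenvalue ?A k \<longleftrightarrow> ?R")
proof
  assume "eigenvalue ?A k"
  then obtain v where v: "v \<in> carrier_vec n" "v \<noteq> 0\<^sub>v n" and e: "?A *\<^sub>v v = k \<cdot>\<^sub>v v"
    by (auto simp: eigenvalue_def eigenvector_def)
  have "\<exists>i<n. v $ i \<noteq> 0"
    using v by (metis carrier_vecD eq_vecI index_zero_vec(1) index_zero_vec(2))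
  moreover have "(\<Sum>j<n. a i j * v $ j) = k * v $ i" if "i < n" for i
  proof -
    have "(?A *\<^sub>v v) $ i = (k \<cdot>\<^sub>v v) $ i" by (simp only: e)
    then show ?thesis using that v by (simp add: scalar_prod_def lessThan_atLeast0)
  qed
  ultimately show ?R by (intro exI[of _ "\<lambda>i. v $ i"]) auto
next
  assume ?R
  then obtain x i where i: "i < n" "x i \<noteq> 0"
    and e: "\<forall>i<n. (\<Sum>j<n. a i j * x j) = k * x i" by auto
  have "vec n x \<noteq> 0\<^sub>v n" using i by (metis index_vec index_zero_vec(1))
  moreover have "?A *\<^sub>v vec n x = k \<cdot>\<^sub>v vec n x"
    using e by (intro eq_vecI) (auto simp: scalar_prod_def lessThan_atLeast0)
  ultimately show "eigenvalue ?A k"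
    unfolding eigenvalue_def eigenvector_def by (intro exI[of _ "vec n x"]) auto
qed

lemma finite_eigenvalues:
  fixes a :: "nat \<Rightarrow> nat \<Rightarrow> real"
  shows "finite {k. eigenvalue (mat n n (\<lambda>(i, j). a i j)) k}"
proof -
  have A: "mat n n (\<lambda>(i, j). a i j) \<in> carrier_mat n n" by simp
  show ?thesis
    unfolding eigenvalue_root_char_poly[OF A]
    using degree_monic_char_poly[OF A] by (intro poly_roots_finite) auto
qed

text \<open>Coordinates from n on do not enter the form, so the unit sphere in this function space
  is unbounded in those directions. Intersecting it with the cube [-1,1] in all coordinates, compact
  by Tychonoff, restores compactness without losing any value of the form.\<close>

lemma quad_form_attains_max:
  assumes "0 < n"
  shows "\<exists>x. (\<Sum>i<n. (x i)\<^sup>2) = 1 \<and>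
    (\<forall>y. quad_form n a y \<le> quad_form n a x * (\<Sum>i<n. (y i)\<^sup>2))"
proof -
  define S :: "(nat \<Rightarrow> real) set"
    where "S = (\<Pi>\<^sub>E i\<in>UNIV. {-1..1}) \<inter> {x. (\<Sum>i<n. (x i)\<^sup>2) = 1}"
  have "compactin (product_topology (\<lambda>i. euclidean) UNIV) (\<Pi>\<^sub>E i\<in>(UNIV::nat set). {-1..1::real})"
    by (subst compactin_PiE) auto
  then have "compact (\<Pi>\<^sub>E i\<in>(UNIV::nat set). {-1..1::real})"
    by (simp add: euclidean_product_topology)
  moreover have "closed {x::nat \<Rightarrow> real. (\<Sum>i<n. (x i)\<^sup>2) = 1}"
    by (intro closed_Collect_eq continuous_intros continuous_on_product_coordinates)
  ultimately have "compact S"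
    unfolding S_def by (rule compact_Int_closed)
  moreover have "(\<Sum>i<n. ((if i = 0 then 1 else 0)::real)\<^sup>2) = (\<Sum>i<n. if i = 0 then 1 else 0)"
    by (intro sum.cong) auto
  then have "(\<lambda>i. if i = 0 then 1 else 0) \<in> S"
    using assms by (simp add: S_def PiE_def)
  then have "S \<noteq> {}" by auto
  moreover have "continuous_on S (quad_form n a)"
    unfolding quad_form_def
    by (rule continuous_on_subset[OF _ subset_UNIV])
      (intro continuous_intros continuous_on_product_coordinates)
  ultimately have "\<exists>x\<in>S. \<forall>z\<in>S. quad_form n a z \<le> quad_form n a x"
    by (intro continuous_attains_sup)
  then obtain x where x: "x \<in> S" and max: "\<And>z. z \<in> S \<Longrightarrow> quad_form n a z \<le> quad_form n a x"
    by blast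
  have "quad_form n a y \<le> quad_form n a x * (\<Sum>i<n. (y i)\<^sup>2)" for y
  proof (cases "(\<Sum>i<n. (y i)\<^sup>2) = 0")
    case True
    then have "\<forall>i<n. y i = 0" by (simp add: sum_nonneg_eq_0_iff)
    then show ?thesis by (simp add: quad_form_def)
  next
    case False
    define s where "s = sqrt (\<Sum>i<n. (y i)\<^sup>2)"
    have "(\<Sum>i<n. (y i)\<^sup>2) > 0" using False by (simp add: order_less_le sum_nonneg)
    then have s: "s > 0" "s\<^sup>2 = (\<Sum>i<n. (y i)\<^sup>2)" by (auto simp: s_def)
    \<comment> \<open>Besides normalising y, this sets the irrelevant coordinates to 0, which puts z
      into the cube.\<close>
    define z where "z i = (if i < n then y i / s else 0)" for i
    have one: "(\<Sum>i<n. (z i)\<^sup>2) = 1"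
      using s False by (simp add: z_def power_divide flip: sum_divide_distrib)
    have "\<bar>z i\<bar> \<le> 1" for i
    proof (cases "i < n")
      case True
      then have "(z i)\<^sup>2 \<le> (\<Sum>i<n. (z i)\<^sup>2)"
        by (intro member_le_sum) auto
      then show ?thesis using one by (simp add: abs_square_le_1)
    qed (simp add: z_def)
    then have "z i \<in> {-1..1}" for i by (simp add: abs_le_iff)
    then have "z \<in> S" using one by (simp add: S_def PiE_def)
    moreover have "quad_form n a z = quad_form n a y / s\<^sup>2"
      by (simp add: quad_form_def z_def sum_divide_distrib power2_eq_square)
    ultimately have "quad_form n a y / s\<^sup>2 \<le> quad_form n a x"
      using max by metis
    then have "quad_form n a y \<le> quad_form n a x * s\<^sup>2" using s(1) by (simp add: pos_divide_le_eq)
    then show ?thesis by (simp only: s(2))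
  qed
  then show ?thesis using x by (auto simp: S_def)
qed

text \<open>First-order condition without calculus: changing coordinate k by t changes the two sides
  of \<open>le\<close> by explicit quadratics in t, and equality at t = 0 forces the linear
  coefficient, twice the k-th entry of the residual, to vanish.\<close>

lemma quad_form_extremal_imp_eigenvector:
  assumes sym: "\<And>i j. a i j = a j i"
    and le: "\<And>y. quad_form n a y \<le> l * (\<Sum>i<n. (y i)\<^sup>2)"
    and eq: "quad_form n a x = l * (\<Sum>i<n. (x i)\<^sup>2)"
    and k: "k < n"
  shows "(\<Sum>j<n. a k j * x j) = l * x k"
proof -
  define g where "g = (\<Sum>j<n. a k j * x j) - l * x k"
  define y where "y t i = x i + (if i = k then t else 0)" for t :: real and i
  have sq: "(\<Sum>i<n. (y t i)\<^sup>2) = (\<Sum>i<n. (x i)\<^sup>2) + 2 * t * x k + t\<^sup>2" for t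
  proof -
    have "(\<Sum>i<n. (y t i)\<^sup>2) = (\<Sum>i<n. (x i)\<^sup>2 + (if i = k then 2 * t * x k + t\<^sup>2 else 0))"
      by (intro sum.cong) (auto simp: y_def power2_sum)
    then show ?thesis using k by (simp add: sum.distrib)
  qed
  have row: "(\<Sum>j<n. a i j * y t j) = (\<Sum>j<n. a i j * x j) + t * a i k" for t i
  proof -
    have "(\<Sum>j<n. a i j * y t j) = (\<Sum>j<n. a i j * x j + (if j = k then t * a i k else 0))"
      by (intro sum.cong) (auto simp: y_def algebra_simps)
    then show ?thesis using k by (simp add: sum.distrib)
  qed
  have col: "(\<Sum>i<n. x i * a i k) = (\<Sum>j<n. a k j * x j)"
    by (intro sum.cong) (auto simp: sym)
  have qf: "quad_form n a (y t) = quad_form n a x + 2 * t * (\<Sum>j<n. a k j * x j) + t\<^sup>2 * a k k" for t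
  proof -
    have "quad_form n a (y t) = (\<Sum>i<n. y t i * ((\<Sum>j<n. a i j * x j) + t * a i k))"
      by (simp add: quad_form_eq row)
    also have "\<dots> = (\<Sum>i<n. x i * (\<Sum>j<n. a i j * x j) + t * (x i * a i k)
        + (if i = k then t * ((\<Sum>j<n. a k j * x j) + t * a k k) else 0))"
      by (intro sum.cong) (auto simp: y_def algebra_simps)
    also have "\<dots> = quad_form n a x + t * (\<Sum>j<n. a k j * x j) + t * ((\<Sum>j<n. a k j * x j) + t * a k k)"
      using k by (simp add: sum.distrib quad_form_eq col flip: sum_distrib_left)
    finally show ?thesis by (simp add: algebra_simps power2_eq_square)
  qed
  have main: "2 * t * g \<le> t\<^sup>2 * (l - a k k)" for t
    using le[of "y t"] unfolding sq qf eq g_def by (simp add: algebra_simps)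
  \<comment> \<open>With c a positive upper bound of \<open>l - a k k\<close>, the choice t = g / c
    turns \<open>main\<close> into 2 g^2 <= g^2; the added 1 makes the division legitimate.\<close>
  define c where "c = \<bar>l - a k k\<bar> + 1"
  have c: "c > 0" "l - a k k \<le> c" by (auto simp: c_def)
  have "2 * (g / c) * g \<le> (g / c)\<^sup>2 * c"
    using main[of "g / c"] c by (meson mult_left_mono order_trans zero_le_power2)
  then have "2 * g\<^sup>2 \<le> g\<^sup>2" using c by (simp add: power2_eq_square field_simps)
  then show ?thesis by (simp add: g_def)
qed

text \<open>Links \<open>rho\<close>, a maximum of eigenvalues, to the Rayleigh quotient. A
  maximising unit vector is an eigenvector, so its value is an eigenvalue; conversely every
  eigenvalue is the quotient at its own eigenvector.\<close>

lemma
  assumes sym: "\<And>i j. a i j = a j i" and n: "0 < n"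
  shows quad_form_le_rho:
      "quad_form n a y \<le> rho (mat n n (\<lambda>(i, j). a i j)) * (\<Sum>i<n. (y i)\<^sup>2)"
    and quad_form_attains_rho:
      "\<exists>x. (\<Sum>i<n. (x i)\<^sup>2) = 1 \<and> quad_form n a x = rho (mat n n (\<lambda>(i, j). a i j))"
proof -
  obtain x where x: "(\<Sum>i<n. (x i)\<^sup>2) = 1"
    and max: "\<And>y. quad_form n a y \<le> quad_form n a x * (\<Sum>i<n. (y i)\<^sup>2)"
    using quad_form_attains_max[OF n] by blast
  have "\<forall>i<n. (\<Sum>j<n. a i j * x j) = quad_form n a x * x i"
    using quad_form_extremal_imp_eigenvector[of a n, OF sym max, of x] x by simp
  moreover have "\<exists>i<n. x i \<noteq> 0"
  proof (rule ccontr)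
    assume "\<not> ?thesis"
    then have "(\<Sum>i<n. (x i)\<^sup>2) = 0" by simp
    then show False using x by simp
  qed
  ultimately have "eigenvalue (mat n n (\<lambda>(i, j). a i j)) (quad_form n a x)"
    unfolding eigenvalue_mat_iff by blast
  moreover have "k \<le> quad_form n a x" if "eigenvalue (mat n n (\<lambda>(i, j). a i j)) k" for k
  proof -
    from that obtain z i where i: "i < n" "z i \<noteq> 0"
      and e: "\<forall>i<n. (\<Sum>j<n. a i j * z j) = k * z i"
      unfolding eigenvalue_mat_iff by blast
    have "0 < (\<Sum>i<n. (z i)\<^sup>2)" using i by (intro sum_pos2[of _ i]) auto
    moreover have "quad_form n a z = k * (\<Sum>i<n. (z i)\<^sup>2)"
      using e by (simp add: quad_form_eq sum_distrib_left power2_eq_square mult_ac)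
    ultimately show ?thesis using max[of z] by simp
  qed
  ultimately have r: "rho (mat n n (\<lambda>(i, j). a i j)) = quad_form n a x"
    unfolding rho_def by (intro Max_eqI finite_eigenvalues) auto
  show "quad_form n a y \<le> rho (mat n n (\<lambda>(i, j). a i j)) * (\<Sum>i<n. (y i)\<^sup>2)"
    using max r by simp
  show "\<exists>x. (\<Sum>i<n. (x i)\<^sup>2) = 1 \<and> quad_form n a x = rho (mat n n (\<lambda>(i, j). a i j))"
    using x r by auto
qed

text \<open>Taking absolute values cannot lower a form with nonnegative entries, so a maximiser may
  be chosen nonnegative. A zero entry of it makes a row sum of nonnegative terms vanish and hence
  spreads to all neighbours; by connectivity the whole vector would be 0.\<close>

lemma perron_vector:
  assumes sym: "\<And>i j. a i j = a j i" and n: "0 < n" and nonneg: "\<And>i j. 0 \<le> a i j"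
    and conn: "\<And>i j. i < n \<Longrightarrow> j < n \<Longrightarrow> (\<lambda>i j. i < n \<and> j < n \<and> 0 < a i j)\<^sup>*\<^sup>* i j"
  shows "\<exists>x. (\<Sum>i<n. (x i)\<^sup>2) = 1 \<and> (\<forall>i<n. 0 < x i) \<and>
    (\<forall>i<n. (\<Sum>j<n. a i j * x j) = rho (mat n n (\<lambda>(i, j). a i j)) * x i)"
proof -
  define l where "l = rho (mat n n (\<lambda>(i, j). a i j))"
  obtain z where z: "(\<Sum>i<n. (z i)\<^sup>2) = 1" "quad_form n a z = l"
    using quad_form_attains_rho[of a n, OF sym n] l_def by blast
  define x where "x i = \<bar>z i\<bar>" for i
  have x1: "(\<Sum>i<n. (x i)\<^sup>2) = 1" using z by (simp add: x_def)
  have "quad_form n a z \<le> quad_form n a x"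
    unfolding quad_form_def x_def
    by (intro sum_mono) (metis abs_ge_self abs_mult abs_of_nonneg nonneg)
  then have "quad_form n a x = l * (\<Sum>i<n. (x i)\<^sup>2)"
    using quad_form_le_rho[of a n x, OF sym n] z x1 by (simp add: l_def)
  then have e: "(\<Sum>j<n. a i j * x j) = l * x i" if "i < n" for i
    using quad_form_extremal_imp_eigenvector[of a n l x, OF sym _ _ that]
      quad_form_le_rho[of a n, OF sym n] l_def by blast
  have step: "x j = 0" if "x i = 0" "i < n" "j < n" "0 < a i j" for i j
  proof -
    have "(\<Sum>j<n. a i j * x j) = 0" using e that by simp
    then have "\<forall>j\<in>{..<n}. a i j * x j = 0"
      using nonneg by (subst (asm) sum_nonneg_eq_0_iff) (simp_all add: x_def)
    then have "a i j * x j = 0" using that by blast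
    then show ?thesis using that by simp
  qed
  have "0 < x i" if "i < n" for i
  proof (rule ccontr)
    assume "\<not> 0 < x i"
    then have "x i = 0" by (simp add: x_def)
    have "x j = 0" if "j < n" for j
      using conn[OF \<open>i < n\<close> that] by (induction rule: rtranclp_induct) (use \<open>x i = 0\<close> step in auto)
    then show False using x1 by simp
  qed
  then show ?thesis using x1 e l_def by blast
qed

subsection \<open>The Kelmans transformation\<close>

lemma property_P_star_commute: "property_P_star f \<Longrightarrow> f x y = f y x"
  unfolding property_P_star_def by blast

lemma property_P_star_pos: "property_P_star f \<Longrightarrow> 0 < x \<Longrightarrow> 0 < y \<Longrightarrow> 0 < f x y"
  unfolding property_P_star_def by blast

lemma property_P_star_mono:
  assumes "property_P_star f" "0 < x" "x \<le> x'" "0 < y"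
  shows "f x y \<le> f x' y"
proof -
  obtain fx where fx: "\<And>x y. 0 < x \<Longrightarrow> 0 < y \<Longrightarrow>
      ((\<lambda>t. f t y) has_real_derivative fx x y) (at x) \<and> fx x y \<ge> 0"
    using assms(1) unfolding property_P_star_def by metis
  show ?thesis
    using assms(2,4) fx by (intro DERIV_nonneg_imp_nondecreasing[OF assms(3)]) (meson order_less_le_trans)
qed

text \<open>Convexity in difference form: the derivative of \<open>f (t + d) y - f t y\<close> in t
  is nonnegative because \<open>fx\<close> is nondecreasing. It is needed for common neighbours of u
  and v, where a loss at v must be outweighed by a gain at u.\<close>

lemma property_P_star_increment_mono:
  assumes "property_P_star f" "0 < x" "x \<le> x'" "0 \<le> d" "0 < y"
  shows "f (x + d) y - f x y \<le> f (x' + d) y - f x' y"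
proof -
  obtain fx fxx where fx: "\<And>x y. 0 < x \<Longrightarrow> 0 < y \<Longrightarrow>
      ((\<lambda>t. f t y) has_real_derivative fx x y) (at x) \<and>
      ((\<lambda>t. fx t y) has_real_derivative fxx x y) (at x) \<and> fxx x y \<ge> 0"
    using assms(1) unfolding property_P_star_def by metis
  have fx_mono: "fx t y \<le> fx (t + d) y" if "0 < t" for t
    using assms(4,5) fx that
    by (intro DERIV_nonneg_imp_nondecreasing[where f = "\<lambda>t. fx t y"]) (simp, meson order_less_le_trans)
  show ?thesis
  proof (rule DERIV_nonneg_imp_nondecreasing[OF assms(3)])
    fix t assume "x \<le> t" "t \<le> x'"
    then have t: "0 < t" "0 < t + d" using assms by auto
    have "((\<lambda>t. f (t + d) y) has_real_derivative fx (t + d) y) (at t)"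
      using fx[OF t(2) assms(5)] by (simp only: DERIV_shift[of "\<lambda>t. f t y"])
    then have "((\<lambda>t. f (t + d) y - f t y) has_real_derivative fx (t + d) y - fx t y) (at t)"
      using fx[OF t(1) assms(5)] by (intro DERIV_diff) auto
    then show "\<exists>D. ((\<lambda>t. f (t + d) y - f t y) has_real_derivative D) (at t) \<and> D \<ge> 0"
      using fx_mono[OF t(1)] by force
  qed
qed

section \<open>Neighbourhoods, degrees and the handshake lemma\<close>

definition nbrs :: "nat \<Rightarrow> (nat \<Rightarrow> nat \<Rightarrow> bool) \<Rightarrow> nat \<Rightarrow> nat set" where
  "nbrs n E i = {j. j < n \<and> E i j}"

lemma mem_nbrs [simp]: "j \<in> nbrs n E i \<longleftrightarrow> j < n \<and> E i j"
  by (simp add: nbrs_def)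

lemma finite_nbrs [simp]: "finite (nbrs n E i)"
  by (simp add: nbrs_def)

lemma degree_eq_card_nbrs: "degree n E i = card (nbrs n E i)"
  by (simp add: degree_def nbrs_def)

lemma degree_pos: "simple_graph n E \<Longrightarrow> E i j \<Longrightarrow> 0 < degree n E i"
  unfolding degree_eq_card_nbrs card_gt_0_iff by (auto simp: simple_graph_def nbrs_def)

lemma sum_degree_eq_num_edges:
  assumes "simple_graph n E"
  shows "(\<Sum>i<n. degree n E i) = 2 * num_edges n E"
proof -
  \<comment> \<open>\<open>num_edges\<close> counts each edge once, with i < j; L together with its
    mirror image is the set of all ordered adjacent pairs.\<close>
  define L where "L = {(i, j). i < j \<and> j < n \<and> E i j}"
  have "finite L"
    by (rule finite_subset[of _ "{..<n} \<times> {..<n}"]) (auto simp: L_def)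
  have "(\<Sum>i<n. degree n E i) = card (SIGMA i:{..<n}. nbrs n E i)"
    by (simp add: degree_eq_card_nbrs)
  also have "(SIGMA i:{..<n}. nbrs n E i) = L \<union> prod.swap ` L"
  proof -
    have "(i, j) \<in> L \<union> prod.swap ` L \<longleftrightarrow> (i, j) \<in> L \<or> (j, i) \<in> L" for i j
      by (force simp: image_iff)
    moreover have "(i, j) \<in> (SIGMA i:{..<n}. nbrs n E i) \<longleftrightarrow> (i, j) \<in> L \<or> (j, i) \<in> L" for i j
      using assms by (auto simp: L_def simple_graph_def) (metis linorder_neqE_nat)
    ultimately show ?thesis unfolding set_eq_iff by (metis surj_pair)
  qed
  also have "card (L \<union> prod.swap ` L) = card L + card (prod.swap ` L)"
    using \<open>finite L\<close> by (intro card_Un_disjoint) (auto simp: L_def)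
  also have "card (prod.swap ` L) = card L"
    by (intro card_image inj_on_subset[OF inj_swap]) auto
  finally show ?thesis by (simp add: num_edges_def L_def)
qed

text \<open>The exclusion of v keeps a possible edge between u and v out of the transformation and
  out of the comparison of neighbourhoods.\<close>

definition private_nbrs :: "(nat \<Rightarrow> nat \<Rightarrow> bool) \<Rightarrow> nat \<Rightarrow> nat \<Rightarrow> nat set" where
  "private_nbrs E u v = {w. E u w \<and> \<not> E v w \<and> w \<noteq> v}"

definition kelmans :: "(nat \<Rightarrow> nat \<Rightarrow> bool) \<Rightarrow> nat \<Rightarrow> nat \<Rightarrow> nat \<Rightarrow> nat \<Rightarrow> bool" where
  "kelmans E u v i j \<longleftrightarrow>
     (E i j \<and> \<not> (i = v \<and> j \<in> private_nbrs E v u) \<and> \<not> (j = v \<and> i \<in> private_nbrs E v u)) \<or>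
     (i = u \<and> j \<in> private_nbrs E v u) \<or> (j = u \<and> i \<in> private_nbrs E v u)"

lemma simple_graph_kelmans:
  assumes "simple_graph n E" "u < n"
  shows "simple_graph n (kelmans E u v)"
  using assms unfolding simple_graph_def kelmans_def private_nbrs_def by blast

lemma private_nbrs_subset: "simple_graph n E \<Longrightarrow> private_nbrs E v u \<subseteq> nbrs n E v"
  by (auto simp: simple_graph_def private_nbrs_def)

lemma finite_private_nbrs: "simple_graph n E \<Longrightarrow> finite (private_nbrs E v u)"
  by (rule finite_subset[OF private_nbrs_subset finite_nbrs])

text \<open>The summand in the inner parentheses is symmetric in s and t, so one and the same
  constant c occurs in the degrees of both vertices.\<close>

lemma degree_eq_private_plus_common:
  assumes E: "simple_graph n E" and "s \<noteq> t"
  shows "degree n E s =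
    card (private_nbrs E s t) + (card (nbrs n E s \<inter> nbrs n E t) + (if E s t then 1 else 0))"
proof -
  let ?C = "(nbrs n E s \<inter> nbrs n E t) \<union> (if E s t then {t} else {})"
  have irr: "\<not> E i i" and lt: "E i j \<Longrightarrow> j < n" for i j
    using E by (auto simp: simple_graph_def)
  have N: "nbrs n E s = private_nbrs E s t \<union> ?C"
    using lt by (auto simp: private_nbrs_def)
  have "private_nbrs E s t \<inter> ?C = {}"
    using irr by (auto simp: private_nbrs_def)
  moreover have "finite (private_nbrs E s t)"
    by (rule finite_private_nbrs[OF E])
  ultimately have "card (private_nbrs E s t \<union> ?C) = card (private_nbrs E s t) + card ?C"
    by (intro card_Un_disjoint) auto
  then have "card (nbrs n E s) = card (private_nbrs E s t) + card ?C"
    by (simp only: flip: N)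
  moreover have "card ?C = card (nbrs n E s \<inter> nbrs n E t) + (if E s t then 1 else 0)"
    using irr by (subst card_Un_disjoint) auto
  ultimately show ?thesis by (simp add: degree_eq_card_nbrs)
qed

text \<open>With a and b private neighbours, the degrees of u and v change from a + c, b + c to a +
  b + c, c. The sum is kept while the gap grows from |a - b| to a + b, which is the situation of the
  spreading clause of property P*.\<close>

lemma kelmans_degrees:
  assumes E: "simple_graph n E" and u: "u < n" and v: "v < n" and "u \<noteq> v"
    and c: "c = card (nbrs n E u \<inter> nbrs n E v) + (if E u v then 1 else 0)"
  shows "degree n E u = card (private_nbrs E u v) + c"
    and "degree n E v = card (private_nbrs E v u) + c"
    and "degree n (kelmans E u v) u = card (private_nbrs E u v) + card (private_nbrs E v u) + c"
    and "degree n (kelmans E u v) v = c"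
    and "w \<noteq> u \<Longrightarrow> w \<noteq> v \<Longrightarrow> degree n (kelmans E u v) w = degree n E w"
proof -
  let ?A = "private_nbrs E u v" and ?B = "private_nbrs E v u"
  have sym: "E i j \<Longrightarrow> E j i" and irr: "\<not> E i i" and lt: "E i j \<Longrightarrow> i < n \<and> j < n" for i j
    using E by (auto simp: simple_graph_def)
  have fin: "finite ?A" "finite ?B"
    by (rule finite_private_nbrs[OF E])+
  have Euv: "E v u \<longleftrightarrow> E u v" using sym by blast
  show du: "degree n E u = card ?A + c"
    using degree_eq_private_plus_common[OF E \<open>u \<noteq> v\<close>] c by simp
  show dv: "degree n E v = card ?B + c"
    using degree_eq_private_plus_common[OF E \<open>u \<noteq> v\<close>[symmetric]] c Euv by (simp add: Int_commute)
  have B: "w \<in> ?B \<longleftrightarrow> E v w \<and> \<not> E u w \<and> w \<noteq> u" for w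
    by (simp add: private_nbrs_def)
  have BN: "?B \<subseteq> nbrs n E v" by (rule private_nbrs_subset[OF E])
  have "kelmans E u v u j \<longleftrightarrow> E u j \<or> j \<in> ?B" for j
    unfolding kelmans_def B using irr \<open>u \<noteq> v\<close> by blast
  then have "nbrs n (kelmans E u v) u = nbrs n E u \<union> ?B"
    using BN by auto
  moreover have "card (nbrs n E u \<union> ?B) = card (nbrs n E u) + card ?B"
    using fin by (intro card_Un_disjoint) (auto simp: B)
  ultimately show "degree n (kelmans E u v) u = card ?A + card ?B + c"
    using du by (simp add: degree_eq_card_nbrs)
  have "kelmans E u v v j \<longleftrightarrow> E v j \<and> j \<notin> ?B" for j
    unfolding kelmans_def B using irr \<open>u \<noteq> v\<close> by blast
  then have "nbrs n (kelmans E u v) v = nbrs n E v - ?B"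
    unfolding nbrs_def by blast
  then show "degree n (kelmans E u v) v = c"
    using dv card_Diff_subset[OF fin(2) BN] by (simp add: degree_eq_card_nbrs)
  show "degree n (kelmans E u v) w = degree n E w" if w: "w \<noteq> u" "w \<noteq> v"
  proof (cases "w \<in> ?B")
    \<comment> \<open>A moved neighbour trades v for u, so its degree is unchanged.\<close>
    case True
    have "kelmans E u v w j \<longleftrightarrow> j = u \<or> (E w j \<and> j \<noteq> v)" for j
      unfolding kelmans_def using True w by blast
    then have "nbrs n (kelmans E u v) w = insert u (nbrs n E w - {v})"
      unfolding nbrs_def using u by blast
    moreover have "u \<notin> nbrs n E w" "v \<in> nbrs n E w"
      using True sym v by (auto simp: B)
    ultimately show ?thesis
      using card_Suc_Diff1[of "nbrs n E w" v] by (simp add: degree_eq_card_nbrs del: mem_nbrs)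
  next
    case False
    then have "kelmans E u v w j \<longleftrightarrow> E w j" for j
      unfolding kelmans_def using w by blast
    then have "nbrs n (kelmans E u v) w = nbrs n E w"
      by (simp add: nbrs_def)
    then show ?thesis by (simp add: degree_eq_card_nbrs)
  qed
qed

text \<open>By the handshake lemma it suffices to compare degree sums, and only the degrees of u and
  v change.\<close>

lemma num_edges_kelmans:
  assumes E: "simple_graph n E" and u: "u < n" and v: "v < n" and "u \<noteq> v"
  shows "num_edges n (kelmans E u v) = num_edges n E"
proof -
  have split: "(\<Sum>i<n. g i) = g u + g v + (\<Sum>i\<in>{..<n} - {u, v}. g i)" for g :: "nat \<Rightarrow> nat"
  proof -
    have "{..<n} = insert u (insert v ({..<n} - {u, v}))" using u v by auto
    then have "sum g {..<n} = sum g (insert u (insert v ({..<n} - {u, v})))" by simp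
    then show ?thesis using \<open>u \<noteq> v\<close> by simp
  qed
  have "(\<Sum>i<n. degree n (kelmans E u v) i) = (\<Sum>i<n. degree n E i)"
    unfolding split using kelmans_degrees[OF assms refl] by simp
  then show ?thesis
    using sum_degree_eq_num_edges[OF E] sum_degree_eq_num_edges[OF simple_graph_kelmans[OF E u, of v]]
    by simp
qed

text \<open>The edge between u and v, or a path through a common neighbour, survives the
  transformation; every deleted edge from v to j is then replaced by the detour from v to u and on
  to j.\<close>

lemma connected_graph_kelmans:
  assumes E: "simple_graph n E" "connected_graph n E" and "u \<noteq> v"
    and near: "E u v \<or> (\<exists>w. E u w \<and> E v w)"
  shows "connected_graph n (kelmans E u v)"
proof -
  let ?K = "kelmans E u v"
  have sym: "E i j \<Longrightarrow> E j i" and irr: "\<not> E i i" for i j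
    using E by (auto simp: simple_graph_def)
  have Ksym: "?K i j \<Longrightarrow> ?K j i" for i j
    using sym by (auto simp: kelmans_def)
  have uv: "?K\<^sup>*\<^sup>* u v"
  proof (cases "E u v")
    case True
    then have "?K u v" by (auto simp: kelmans_def private_nbrs_def irr)
    then show ?thesis by blast
  next
    case False
    then obtain w where w: "E u w" "E v w" using near by blast
    then have "?K u w" "?K w v"
      using irr sym \<open>u \<noteq> v\<close> by (auto simp: kelmans_def private_nbrs_def)
    then show ?thesis by (meson r_into_rtranclp rtranclp_trans)
  qed
  have "?K\<^sup>*\<^sup>* i j \<Longrightarrow> ?K\<^sup>*\<^sup>* j i" for i j
    by (induction rule: rtranclp_induct) (auto intro: converse_rtranclp_into_rtranclp Ksym)
  then have vu: "?K\<^sup>*\<^sup>* v u" using uv by blast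
  have step: "?K\<^sup>*\<^sup>* i j" if ij: "E i j" for i j
  proof (cases "?K i j")
    case False
    then consider "i = v" "j \<in> private_nbrs E v u" | "j = v" "i \<in> private_nbrs E v u"
      using ij by (auto simp: kelmans_def)
    then show ?thesis
    proof cases
      case 1
      then have "?K u j" by (simp add: kelmans_def)
      then show ?thesis using vu 1 by (metis rtranclp.rtrancl_into_rtrancl)
    next
      case 2
      then have "?K i u" by (simp add: kelmans_def)
      then show ?thesis using uv 2 by (metis converse_rtranclp_into_rtranclp)
    qed
  next
    case True
    then show ?thesis by (rule r_into_rtranclp)
  qed
  have "E\<^sup>*\<^sup>* i j \<Longrightarrow> ?K\<^sup>*\<^sup>* i j" for i j
    by (induction rule: rtranclp_induct) (auto intro: rtranclp_trans step)
  then show ?thesis using E(2) by (simp add: connected_graph_def)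
qed

lemma bicyclic_kelmans:
  assumes "bicyclic n E" "u < n" "v < n" "u \<noteq> v" "E u v \<or> (\<exists>w. E u w \<and> E v w)"
  shows "bicyclic n (kelmans E u v)"
  using assms simple_graph_kelmans num_edges_kelmans connected_graph_kelmans
  by (simp add: bicyclic_def)

subsection \<open>Effect on the largest eigenvalue\<close>

text \<open>The matrix entries as a function on all pairs of naturals, so that symmetry and
  nonnegativity hold without index bounds, as the lemmas on \<open>quad_form\<close>
  require.\<close>

definition weight :: "(real \<Rightarrow> real \<Rightarrow> real) \<Rightarrow> nat \<Rightarrow> (nat \<Rightarrow> nat \<Rightarrow> bool) \<Rightarrow> nat \<Rightarrow> nat \<Rightarrow> real" where
  "weight f n E i j = (if E i j then f (real (degree n E i)) (real (degree n E j)) else 0)"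

lemma A_f_eq: "A_f f n E = mat n n (\<lambda>(i, j). weight f n E i j)"
  by (simp add: A_f_def weight_def)

lemma weight_commute:
  "property_P_star f \<Longrightarrow> simple_graph n E \<Longrightarrow> weight f n E i j = weight f n E j i"
  unfolding weight_def simple_graph_def by (metis property_P_star_commute)

lemma weight_pos:
  "property_P_star f \<Longrightarrow> simple_graph n E \<Longrightarrow> E i j \<Longrightarrow> 0 < weight f n E i j"
proof -
  assume f: "property_P_star f" and E: "simple_graph n E" and ij: "E i j"
  then have "E j i" by (simp add: simple_graph_def)
  then have "0 < real (degree n E i)" "0 < real (degree n E j)"
    using degree_pos[OF E] ij by simp_all
  then show ?thesis using property_P_star_pos[OF f] ij by (simp add: weight_def)
qed

lemma weight_nonneg:
  "property_P_star f \<Longrightarrow> simple_graph n E \<Longrightarrow> 0 \<le> weight f n E i j"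
  using weight_pos[of f n E i j] by (cases "E i j") (simp_all add: weight_def)

lemma A_f_perron_vector:
  assumes f: "property_P_star f" and E: "simple_graph n E" "connected_graph n E" and "0 < n"
  shows "\<exists>x. (\<Sum>i<n. (x i)\<^sup>2) = 1 \<and> (\<forall>i<n. 0 < x i) \<and>
    (\<forall>i<n. (\<Sum>j<n. weight f n E i j * x j) = rho (A_f f n E) * x i)"
  unfolding A_f_eq
proof (rule perron_vector)
  show "weight f n E i j = weight f n E j i" for i j by (rule weight_commute[OF f E(1)])
  show "0 \<le> weight f n E i j" for i j by (rule weight_nonneg[OF f E(1)])
  show "0 < n" by fact
  fix i j assume "i < n" "j < n"
  then have "E\<^sup>*\<^sup>* i j" using E by (simp add: connected_graph_def)
  moreover have "E \<le> (\<lambda>i j. i < n \<and> j < n \<and> 0 < weight f n E i j)"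
    using E(1) weight_pos[OF f E(1)] by (auto simp: simple_graph_def)
  ultimately show "(\<lambda>i j. i < n \<and> j < n \<and> 0 < weight f n E i j)\<^sup>*\<^sup>* i j"
    using rtranclp_mono by blast
qed

text \<open>Meant for the difference of the weights after and before a transformation, which lives
  on rows and columns u and v. Grouping by the third vertex w sets the gain at u against the loss at
  v.\<close>

lemma quad_form_two_rows:
  assumes sym: "\<And>i j. d i j = d j i" and uv: "u < n" "v < n" "u \<noteq> v"
    and zero: "\<And>i j. i \<notin> {u, v} \<Longrightarrow> j \<notin> {u, v} \<Longrightarrow> d i j = 0" "d u u = 0" "d v v = 0"
  shows "quad_form n d x =
    2 * (d u v * x u * x v) + 2 * (\<Sum>w\<in>{..<n} - {u, v}. x w * (d u w * x u + d v w * x v))"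
proof -
  let ?R = "{..<n} - {u, v}"
  have split: "(\<Sum>i<n. g i) = g u + g v + (\<Sum>i\<in>?R. g i)" for g :: "nat \<Rightarrow> real"
  proof -
    have "{..<n} = insert u (insert v ?R)" using uv by auto
    then have "sum g {..<n} = sum g (insert u (insert v ?R))" by simp
    then show ?thesis using uv by simp
  qed
  have R0: "(\<Sum>j\<in>?R. d i j * x i * x j) = 0" if "i \<in> ?R" for i
    using that zero by (intro sum.neutral) auto
  have "(\<Sum>j<n. d i j * x i * x j) = x i * (d u i * x u + d v i * x v)" if "i \<in> ?R" for i
    unfolding split R0[OF that] sym[of i u] sym[of i v] by (simp add: algebra_simps)
  then have R: "(\<Sum>i\<in>?R. \<Sum>j<n. d i j * x i * x j) = (\<Sum>i\<in>?R. x i * (d u i * x u + d v i * x v))"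
    by (intro sum.cong) simp_all
  have "(\<Sum>w\<in>?R. x w * (d u w * x u + d v w * x v)) =
      (\<Sum>j\<in>?R. d u j * x u * x j) + (\<Sum>j\<in>?R. d v j * x v * x j)"
    by (simp add: algebra_simps sum.distrib)
  moreover have "quad_form n d x = (\<Sum>j<n. d u j * x u * x j) + (\<Sum>j<n. d v j * x v * x j)
      + (\<Sum>i\<in>?R. x i * (d u i * x u + d v i * x v))"
    unfolding quad_form_def R[symmetric] by (rule split)
  ultimately show ?thesis
    unfolding split using zero(2,3) sym[of v u] by simp
qed

lemma rho_less_kelmans:
  assumes f: "property_P_star f" and E: "simple_graph n E" "connected_graph n E"
    and uv: "u < n" "v < n" "u \<noteq> v"
    and A: "private_nbrs E u v \<noteq> {}" and B: "private_nbrs E v u \<noteq> {}"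
    and near: "E u v \<or> (\<exists>w. E u w \<and> E v w)"
    and x1: "(\<Sum>i<n. (x i)\<^sup>2) = 1" and xpos: "\<forall>i<n. 0 < x i"
    and eig: "\<forall>i<n. (\<Sum>j<n. weight f n E i j * x j) = rho (A_f f n E) * x i"
    and xuv: "x v \<le> x u"
  shows "rho (A_f f n E) < rho (A_f f n (kelmans E u v))"
proof -
  let ?K = "kelmans E u v"
  \<comment> \<open>Edges that stay in place contribute too: their weights change with the degrees
    of u and v.\<close>
  define d where "d i j = weight f n ?K i j - weight f n E i j" for i j
  have K: "simple_graph n ?K" using simple_graph_kelmans E uv by blast
  have sym: "E i j \<Longrightarrow> E j i" and irr: "\<not> E i i" and lt: "E i j \<Longrightarrow> i < n \<and> j < n" for i j
    using E by (auto simp: simple_graph_def)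
  define a b c where "a = real (card (private_nbrs E u v))"
    and "b = real (card (private_nbrs E v u))"
    and "c = real (card (nbrs n E u \<inter> nbrs n E v) + (if E u v then 1 else 0))"
  note deg = kelmans_degrees[OF E(1) uv refl]
  have du: "real (degree n E u) = a + c" and dv: "real (degree n E v) = b + c"
    and du': "real (degree n ?K u) = a + b + c" and dv': "real (degree n ?K v) = c"
    by (simp_all add: deg a_def b_def c_def)
  have "finite (private_nbrs E u v)" "finite (private_nbrs E v u)"
    by (rule finite_private_nbrs[OF E(1)])+
  then have ab: "0 < a" "0 < b" using A B by (auto simp: a_def b_def card_gt_0_iff)
  have c: "0 < c"
  proof (cases "E u v")
    case False
    then have "nbrs n E u \<inter> nbrs n E v \<noteq> {}" using near lt by fastforce
    then show ?thesis by (auto simp: c_def card_gt_0_iff)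
  qed (simp add: c_def)
  have dsym: "d i j = d j i" for i j
    using weight_commute[OF f E(1)] weight_commute[OF f K] by (simp add: d_def)
  have d0: "d i j = 0" if "i \<notin> {u, v}" "j \<notin> {u, v}" for i j
    using that deg(5) by (simp add: d_def weight_def kelmans_def)
  have dd: "d i i = 0" for i
    using E K by (simp add: d_def weight_def simple_graph_def)
  have duv: "0 \<le> d u v"
  proof -
    have "?K u v \<longleftrightarrow> E u v" using uv irr by (auto simp: kelmans_def private_nbrs_def)
    \<comment> \<open>Spreading clause: equal sums, and |a - b| < a + b since a and b are
      positive.\<close>
    moreover have "f (a + c) (b + c) \<le> f (a + b + c) c"
      using f ab c unfolding property_P_star_def by auto
    ultimately show ?thesis by (simp add: d_def weight_def du dv du' dv')
  qed
  have Ku: "?K u w \<longleftrightarrow> E u w \<or> E v w" and Kv: "?K v w \<longleftrightarrow> E u w \<and> E v w"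
    if "w \<notin> {u, v}" for w
    using that uv by (auto simp: kelmans_def private_nbrs_def)
  have duw: "0 \<le> d u w \<and> 0 \<le> d u w * x u + d v w * x v" and duw_pos: "w \<in> private_nbrs E v u \<Longrightarrow> 0 < d u w"
    if w: "w \<notin> {u, v}" for w
  proof -
    define g where "g t = f t (real (degree n E w))" for t
    have d: "d u w = (if E u w \<or> E v w then g (a + b + c) else 0) - (if E u w then g (a + c) else 0)"
      "d v w = (if E u w \<and> E v w then g c else 0) - (if E v w then g (b + c) else 0)"
      using w by (simp_all add: d_def weight_def g_def Ku Kv deg(5) du dv du' dv')
    have x: "0 < x u" "0 < x v" using xpos uv by auto
    have w0: "0 < degree n E w" if "E u w \<or> E v w"
      using that sym degree_pos[OF E(1)] by blast
    have gmono: "g s \<le> g t" if "E u w \<or> E v w" "0 < s" "s \<le> t" for s t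
      unfolding g_def using that w0 by (intro property_P_star_mono[OF f]) auto
    have gpos: "0 < g t" if "E u w \<or> E v w" "0 < t" for t
      unfolding g_def using that w0 by (intro property_P_star_pos[OF f]) auto
    show "0 < d u w" if "w \<in> private_nbrs E v u"
      using that gpos[of "a + b + c"] ab c by (auto simp: d private_nbrs_def)
    \<comment> \<open>An edge only to u gains by monotonicity; an edge only to v is moved to a
      vertex with larger degree and larger entry of x; for edges to both, convexity is needed.
      \<open>d v w\<close> alone may be negative, so only the weighted combination is
      bounded.\<close>
    consider "\<not> E u w" "\<not> E v w" | "E u w" "\<not> E v w" | "\<not> E u w" "E v w" | "E u w" "E v w" by blast
    then show "0 \<le> d u w \<and> 0 \<le> d u w * x u + d v w * x v"
    proof cases
      case 2
      then show ?thesis using gmono[of "a + c" "a + b + c"] ab c x by (simp add: d)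
    next
      case 3
      then have "g (b + c) * x v \<le> g (a + b + c) * x u"
        using ab c x gpos[of "b + c"] gmono[of "b + c" "a + b + c"] xuv by (intro mult_mono) auto
      then show ?thesis using 3 gpos[of "a + b + c"] ab c by (simp add: d)
    next
      case 4
      \<comment> \<open>Raising the degree from c to b + c is worth no more than raising it from a +
        c to a + b + c; then \<open>x v \<le> x u\<close> compares the weighted increments.\<close>
      have "g (c + b) - g c \<le> g (a + c + b) - g (a + c)"
        unfolding g_def using 4 w0 ab c by (intro property_P_star_increment_mono[OF f]) auto
      then have "(g (b + c) - g c) * x v \<le> (g (a + b + c) - g (a + c)) * x u"
        using 4 ab c x xuv gmono[of c "b + c"] by (intro mult_mono) (auto simp: add_ac)
      then show ?thesis using 4 gmono[of "a + c" "a + b + c"] ab c by (simp add: d algebra_simps)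
    qed (simp add: d)
  qed
  have n: "0 < n" using uv by simp
  have q: "quad_form n (weight f n E) x = rho (A_f f n E)"
  proof -
    have "quad_form n (weight f n E) x = (\<Sum>i<n. rho (A_f f n E) * (x i)\<^sup>2)"
      unfolding quad_form_eq using eig by (intro sum.cong) (simp_all add: power2_eq_square)
    then show ?thesis using x1 by (simp flip: sum_distrib_left)
  qed
  have "quad_form n d x = 2 * (d u v * x u * x v)
      + 2 * (\<Sum>w\<in>{..<n} - {u, v}. x w * (d u w * x u + d v w * x v))"
    by (rule quad_form_two_rows) (use dsym uv d0 dd in auto)
  moreover have "0 \<le> d u v * x u * x v"
    using duv xpos uv by (simp add: less_imp_le)
  moreover have "0 \<le> (\<Sum>w\<in>{..<n} - {u, v}. x w * (d u w * x u + d v w * x v))"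
    using duw xpos by (intro sum_nonneg mult_nonneg_nonneg) (auto simp: less_imp_le)
  ultimately have "0 \<le> quad_form n d x" by simp
  moreover have "quad_form n d x = quad_form n (weight f n ?K) x - quad_form n (weight f n E) x"
    by (simp add: quad_form_def d_def left_diff_distrib sum_subtractf)
  ultimately have le: "rho (A_f f n E) \<le> quad_form n (weight f n ?K) x" using q by simp
  have max: "quad_form n (weight f n ?K) y \<le> rho (A_f f n ?K) * (\<Sum>i<n. (y i)\<^sup>2)" for y
    unfolding A_f_eq by (rule quad_form_le_rho[OF weight_commute[OF f K] n])
  \<comment> \<open>If \<open>x\<close> were also extremal for the new graph, it would be an eigenvector there for the
    same eigenvalue, yet row \<open>u\<close> has strictly increased.\<close>
  show ?thesis
  proof (rule ccontr)
    assume "\<not> ?thesis"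
    moreover have "quad_form n (weight f n ?K) x \<le> rho (A_f f n ?K)"
      using max[of x] unfolding x1 by simp
    ultimately have eq: "rho (A_f f n ?K) = rho (A_f f n E)"
      "quad_form n (weight f n ?K) x = rho (A_f f n ?K)"
      using le by linarith+
    have "(\<Sum>j<n. weight f n ?K u j * x j) = rho (A_f f n ?K) * x u"
      using eq x1 by (intro quad_form_extremal_imp_eigenvector[OF weight_commute[OF f K] max _ uv(1)]) simp
    then have row: "(\<Sum>j<n. d u j * x j) = 0"
      using eig uv eq by (simp add: d_def left_diff_distrib sum_subtractf)
    obtain w where w: "w \<in> private_nbrs E v u" using B by blast
    then have "w < n" "w \<notin> {u, v}" using lt irr by (auto simp: private_nbrs_def)
    have "0 \<le> d u j" for j using duw[of j] duv dd by (cases "j \<in> {u, v}") auto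
    then have "0 \<le> d u j * x j" if "j < n" for j using xpos that by (simp add: less_imp_le)
    moreover have "0 < d u w * x w"
      using duw_pos[OF \<open>w \<notin> {u, v}\<close> w] xpos \<open>w < n\<close> by simp
    ultimately have "0 < (\<Sum>j<n. d u j * x j)"
      using \<open>w < n\<close> by (intro sum_pos2[of _ w]) auto
    then show False using row by simp
  qed
qed

text \<open>\<open>private_nbrs E u v = {}\<close> says that every neighbour of u other than v is a
  neighbour of v. The negation supplies exactly a pair to which \<open>rho_less_kelmans\<close>
  applies.\<close>

definition nested_nbrs :: "(nat \<Rightarrow> nat \<Rightarrow> bool) \<Rightarrow> bool" where
  "nested_nbrs E \<longleftrightarrow> (\<forall>u v. u \<noteq> v \<longrightarrow> E u v \<or> (\<exists>w. E u w \<and> E v w) \<longrightarrow>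
     private_nbrs E u v = {} \<or> private_nbrs E v u = {})"

text \<open>The conditions on u and v are symmetric, so the receiving vertex can be chosen after the
  Perron vector is known: it is the one with the larger entry.\<close>

lemma exists_larger_rho:
  assumes f: "property_P_star f" and E: "bicyclic n E" and "\<not> nested_nbrs E"
  shows "\<exists>F. bicyclic n F \<and> rho (A_f f n E) < rho (A_f f n F)"
proof -
  have E': "simple_graph n E" "connected_graph n E" using E by (auto simp: bicyclic_def)
  then have lt: "E i j \<Longrightarrow> i < n" for i j by (auto simp: simple_graph_def)
  from assms(3) obtain u v where uv: "u \<noteq> v" "E u v \<or> (\<exists>w. E u w \<and> E v w)"
    "private_nbrs E u v \<noteq> {}" "private_nbrs E v u \<noteq> {}"
    unfolding nested_nbrs_def by blast
  then have n: "u < n" "v < n" using lt by (auto simp: private_nbrs_def)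
  have vu: "v \<noteq> u" "E v u \<or> (\<exists>w. E v w \<and> E u w)"
    using uv E' by (auto simp: simple_graph_def)
  obtain x where x: "(\<Sum>i<n. (x i)\<^sup>2) = 1" "\<forall>i<n. 0 < x i"
    "\<forall>i<n. (\<Sum>j<n. weight f n E i j * x j) = rho (A_f f n E) * x i"
    using A_f_perron_vector[OF f E'] n by auto
  have "x v \<le> x u \<or> x u \<le> x v" by linarith
  then show ?thesis
  proof
    assume "x v \<le> x u"
    then show ?thesis
      using rho_less_kelmans[OF f E' n uv(1,3,4,2) x] bicyclic_kelmans[OF E n uv(1,2)] by blast
  next
    assume "x u \<le> x v"
    then show ?thesis
      using rho_less_kelmans[OF f E' n(2,1) vu(1) uv(4,3) vu(2) x] bicyclic_kelmans[OF E n(2,1) vu] by blast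
  qed
qed

section \<open>Finiteness of the class and invariance under isomorphism\<close>

lemma finite_bicyclic: "finite {E. bicyclic n E}"
proof (rule finite_subset)
  \<comment> \<open>A simple graph relation is false outside the square of vertices below n, so its
    edge set determines it as a predicate on all naturals.\<close>
  show "{E. bicyclic n E} \<subseteq> (\<lambda>S i j. (i, j) \<in> S) ` Pow ({..<n} \<times> {..<n})"
  proof
    fix E assume "E \<in> {E. bicyclic n E}"
    then show "E \<in> (\<lambda>S i j. (i, j) \<in> S) ` Pow ({..<n} \<times> {..<n})"
      by (intro image_eqI[of _ _ "{(i, j). E i j}"]) (auto simp: bicyclic_def simple_graph_def)
  qed
  show "finite ((\<lambda>S i j. (i, j) \<in> S) ` Pow ({..<n} \<times> {..<n}))"
    by (intro finite_imageI finite_Pow_iff[THEN iffD2] finite_cartesian_product finite_lessThan)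
qed

text \<open>One inequality suffices to pass from a maximiser to B_1. A maximising vector for E,
  transported along the isomorphism, has the same quotient in F.\<close>

lemma rho_le_of_graph_iso:
  assumes f: "property_P_star f" and E: "simple_graph n E" and F: "simple_graph n F"
    and "0 < n" and iso: "graph_iso n E F"
  shows "rho (A_f f n E) \<le> rho (A_f f n F)"
proof -
  obtain p where p: "bij_betw p {..<n} {..<n}"
    and edge: "\<And>i j. i < n \<Longrightarrow> j < n \<Longrightarrow> E i j \<longleftrightarrow> F (p i) (p j)"
    using iso by (auto simp: graph_iso_def atLeast0LessThan)
  have pn: "p i < n" if "i < n" for i using p that by (auto simp: bij_betw_def)
  have deg: "degree n E i = degree n F (p i)" if "i < n" for i
  proof -
    have "p ` nbrs n E i = nbrs n F (p i)"
    proof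
      show "nbrs n F (p i) \<subseteq> p ` nbrs n E i"
      proof
        fix k assume k: "k \<in> nbrs n F (p i)"
        then obtain j where "j < n" "k = p j" using p by (auto simp: bij_betw_def)
        then show "k \<in> p ` nbrs n E i" using k edge that by auto
      qed
    qed (use edge that pn in auto)
    moreover have "inj_on p (nbrs n E i)"
      by (rule inj_on_subset[OF bij_betw_imp_inj_on[OF p]]) auto
    ultimately show ?thesis by (metis card_image degree_eq_card_nbrs)
  qed
  have "\<exists>x. (\<Sum>i<n. (x i)\<^sup>2) = 1 \<and> quad_form n (weight f n E) x = rho (A_f f n E)"
    unfolding A_f_eq by (rule quad_form_attains_rho[OF weight_commute[OF f E] \<open>0 < n\<close>])
  then obtain x where x: "(\<Sum>i<n. (x i)\<^sup>2) = 1" "quad_form n (weight f n E) x = rho (A_f f n E)"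
    by blast
  define y where "y = x \<circ> inv_into {..<n} p"
  have y: "y (p i) = x i" if "i < n" for i
    using p that by (simp add: y_def bij_betw_def)
  have "(\<Sum>i<n. (y i)\<^sup>2) = (\<Sum>i<n. (y (p i))\<^sup>2)"
    by (rule sum.reindex_bij_betw[OF p, symmetric])
  then have y1: "(\<Sum>i<n. (y i)\<^sup>2) = 1" using x y by simp
  have "quad_form n (weight f n F) y = (\<Sum>i<n. \<Sum>j<n. weight f n F (p i) j * y (p i) * y j)"
    unfolding quad_form_def
    by (rule sum.reindex_bij_betw[OF p, where g = "\<lambda>i. \<Sum>j<n. weight f n F i j * y i * y j", symmetric])
  also have "\<dots> = (\<Sum>i<n. \<Sum>j<n. weight f n F (p i) (p j) * y (p i) * y (p j))"
    by (rule sum.cong[OF refl])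
      (rule sum.reindex_bij_betw[OF p, where g = "\<lambda>j. weight f n F (p i) j * y (p i) * y j" for i, symmetric])
  also have "\<dots> = quad_form n (weight f n E) x"
    unfolding quad_form_def using edge deg y by (intro sum.cong refl) (simp add: weight_def)
  finally show ?thesis
    using quad_form_le_rho[of "weight f n F", OF weight_commute[OF f F] \<open>0 < n\<close>, of y] x y1 by (simp add: A_f_eq)
qed

subsection \<open>Bicyclic graphs with nested neighbourhoods\<close>

text \<open>Take u of maximum degree. If w were at distance two from u through v, nesting would put
  all neighbours of u except v into the neighbourhood of v, which also contains u and w; then v
  would have larger degree than u. So u and its neighbours are closed under adjacency, and
  connectivity does the rest.\<close>

lemma nested_nbrs_imp_dominating:
  assumes E: "simple_graph n E" "connected_graph n E" and "0 < n" and nest: "nested_nbrs E"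
  shows "\<exists>u<n. \<forall>w<n. w \<noteq> u \<longrightarrow> E u w"
proof -
  have sym: "E i j \<Longrightarrow> E j i" and irr: "\<not> E i i" and lt: "E i j \<Longrightarrow> i < n \<and> j < n" for i j
    using E by (auto simp: simple_graph_def)
  have "Max (degree n E ` {..<n}) \<in> degree n E ` {..<n}"
    using \<open>0 < n\<close> by (intro Max_in) auto
  then obtain u where u: "u < n" and "degree n E u = Max (degree n E ` {..<n})"
    by force
  then have max: "degree n E v \<le> degree n E u" if "v < n" for v
    using that by simp
  have close: "w = u \<or> E u w" if vw: "E u v" "E v w" for v w
  proof (rule ccontr)
    assume w: "\<not> ?thesis"
    have "u \<noteq> v" using vw irr by blast
    moreover have "w \<in> private_nbrs E v u" using vw w by (simp add: private_nbrs_def)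
    ultimately have "private_nbrs E u v = {}"
      using nest vw unfolding nested_nbrs_def by blast
    then have "insert u (insert w (nbrs n E u - {v})) \<subseteq> nbrs n E v"
      using vw sym lt by (auto simp: private_nbrs_def)
    then have "card (insert u (insert w (nbrs n E u - {v}))) \<le> card (nbrs n E v)"
      by (intro card_mono) auto
    moreover have "card (insert u (insert w (nbrs n E u - {v}))) = Suc (Suc (card (nbrs n E u - {v})))"
      using w irr by (subst card_insert_disjoint; auto)+
    moreover have "Suc (card (nbrs n E u - {v})) = card (nbrs n E u)"
      using vw lt by (intro card_Suc_Diff1) auto
    moreover have "card (nbrs n E v) \<le> card (nbrs n E u)"
      using max vw lt by (simp add: degree_eq_card_nbrs)
    ultimately show False by simp
  qed
  have reach: "w = u \<or> E u w" if "E\<^sup>*\<^sup>* u w" for w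
    using that by (induction rule: rtranclp_induct) (use close in auto)
  have "E u w" if "w < n" "w \<noteq> u" for w
    using reach[of w] that E(2) u by (auto simp: connected_graph_def)
  then show ?thesis using u by blast
qed

text \<open>B_1 with arbitrary vertices u, p, q, r in the roles of 0, 1, 2, 3; the path is q, p, r
  with middle vertex p.\<close>

definition star_plus_path :: "nat \<Rightarrow> nat \<Rightarrow> nat \<Rightarrow> nat \<Rightarrow> nat \<Rightarrow> nat \<Rightarrow> nat \<Rightarrow> bool" where
  "star_plus_path n u p q r i j \<longleftrightarrow> i < n \<and> j < n \<and>
     ((i = u \<and> j \<noteq> u) \<or> (j = u \<and> i \<noteq> u) \<or>
      (i = p \<and> (j = q \<or> j = r)) \<or> (j = p \<and> (i = q \<or> i = r)))"

lemma B1_eq_star_plus_path: "B1 n = star_plus_path n 0 1 2 3"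
  by (intro ext) (simp add: B1_def star_plus_path_def)

lemma graph_iso_star_plus_path:
  assumes n: "u < n" "p < n" "q < n" "r < n" and d: "distinct [u, p, q, r]"
  shows "graph_iso n (star_plus_path n u p q r) (B1 n)"
proof -
  let ?R = "{..<n} - {u, p, q, r}"
  have "card {u, p, q, r} \<le> card {..<n}" using n by (intro card_mono) auto
  then have n4: "4 \<le> n" using d by simp
  have "card ?R = card {4..<n}"
    using n d by (subst card_Diff_subset) auto
  then obtain h where h: "bij_betw h ?R {4..<n}"
    using finite_same_card_bij[of ?R "{4..<n}"] by auto
  define \<pi> where "\<pi> i = (if i = u then 0 else if i = p then 1 else if i = q then 2
    else if i = r then 3 else h i)" for i
  have hR: "4 \<le> h i \<and> h i < n" if "i < n" "i \<noteq> u" "i \<noteq> p" "i \<noteq> q" "i \<noteq> r" for i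
    using bij_betwE[OF h] that by auto
  \<comment> \<open>Knowing the exact preimages of 0, 1, 2, 3 makes both edge relations agree by
    rewriting; the bijection h only handles the pendant vertices.\<close>
  have vals: "\<pi> i = 0 \<longleftrightarrow> i = u" "\<pi> i = 1 \<longleftrightarrow> i = p" "\<pi> i = 2 \<longleftrightarrow> i = q" "\<pi> i = 3 \<longleftrightarrow> i = r"
    if "i < n" for i
    using hR[OF that] d by (auto simp: \<pi>_def)
  have lt: "\<pi> i < n" if "i < n" for i
    using hR[OF that] n4 by (auto simp: \<pi>_def)
  have "inj_on \<pi> {..<n}"
  proof (rule inj_onI)
    fix i j assume ij: "i \<in> {..<n}" "j \<in> {..<n}" and eq: "\<pi> i = \<pi> j"
    show "i = j"
    proof (cases "i \<in> {u, p, q, r}")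
      case True
      then show ?thesis using vals[of i] vals[of j] ij eq by auto
    next
      case False
      then have "j \<notin> {u, p, q, r}" using vals[of i] vals[of j] ij eq by auto
      then have "i \<in> ?R" "j \<in> ?R" "h i = h j" using False ij eq by (auto simp: \<pi>_def)
      then show ?thesis using h by (auto simp: bij_betw_def dest: inj_onD)
    qed
  qed
  moreover from this have "\<pi> ` {..<n} = {..<n}"
    using lt by (intro endo_inj_surj) auto
  ultimately have "bij_betw \<pi> {0..<n} {0..<n}"
    by (simp add: bij_betw_def atLeast0LessThan)
  moreover have "star_plus_path n u p q r i j \<longleftrightarrow> B1 n (\<pi> i) (\<pi> j)" if "i < n" "j < n" for i j
    using that lt vals by (simp add: B1_eq_star_plus_path star_plus_path_def)
  ultimately show ?thesis unfolding graph_iso_def by blast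
qed

lemma num_edges_dominating:
  assumes E: "simple_graph n E" and u: "u < n" and dom: "\<forall>w<n. w \<noteq> u \<longrightarrow> E u w"
  shows "num_edges n E = n - 1 + card {(i, j). i < j \<and> j < n \<and> E i j \<and> i \<noteq> u \<and> j \<noteq> u}"
    (is "_ = _ + card ?Q")
proof -
  have sym: "E i j \<Longrightarrow> E j i" for i j using E by (auto simp: simple_graph_def)
  \<comment> \<open>The n - 1 spokes at u, each oriented increasingly as \<open>num_edges\<close>
    demands.\<close>
  let ?P = "(\<lambda>w. (min u w, max u w)) ` ({..<n} - {u})"
  have "inj_on (\<lambda>w. (min u w, max u w)) ({..<n} - {u})"
    by (rule inj_onI) (auto simp: min_def max_def split: if_splits)
  then have "card ?P = n - 1" using u by (simp add: card_image)
  moreover have "{(i, j). i < j \<and> j < n \<and> E i j} = ?P \<union> ?Q"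
  proof (rule Set.set_eqI)
    fix z :: "nat \<times> nat"
    obtain i j where z: "z = (i, j)" by (cases z)
    have P: "(i, j) \<in> ?P \<longleftrightarrow> i < j \<and> j < n \<and> (i = u \<or> j = u)"
    proof
      assume "i < j \<and> j < n \<and> (i = u \<or> j = u)"
      then show "(i, j) \<in> ?P"
        by (intro image_eqI[of _ _ "if i = u then j else i"]) auto
    qed (use u in \<open>auto simp: min_def max_def split: if_splits\<close>)
    then show "z \<in> {(i, j). i < j \<and> j < n \<and> E i j} \<longleftrightarrow> z \<in> ?P \<union> ?Q"
      unfolding z Un_iff P using dom sym u by auto
  qed
  moreover have "finite ?Q"
    by (rule finite_subset[of _ "{..<n} \<times> {..<n}"]) auto
  moreover have "?P \<inter> ?Q = {}" by (auto simp: min_def max_def split: if_splits)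
  ultimately show ?thesis by (simp add: num_edges_def card_Un_disjoint)
qed

lemma bicyclic_nested_imp_iso_B1:
  assumes E: "bicyclic n E" and "0 < n" and nest: "nested_nbrs E"
  shows "graph_iso n E (B1 n)"
proof -
  have E': "simple_graph n E" "connected_graph n E" using E by (auto simp: bicyclic_def)
  then have sym: "E i j \<Longrightarrow> E j i" and irr: "\<not> E i i" and lt: "E i j \<Longrightarrow> i < n \<and> j < n" for i j
    by (auto simp: simple_graph_def)
  obtain u where u: "u < n" and dom: "\<forall>w<n. w \<noteq> u \<longrightarrow> E u w"
    using nested_nbrs_imp_dominating[OF E' \<open>0 < n\<close> nest] by blast
  define Q where "Q = {(i, j). i < j \<and> j < n \<and> E i j \<and> i \<noteq> u \<and> j \<noteq> u}"
  have "n - 1 + card Q = n + 1"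
    using num_edges_dominating[OF E'(1) u dom] E unfolding bicyclic_def Q_def by metis
  then have "card Q = 2" using \<open>0 < n\<close> by linarith
  then obtain a b a' b' where Q: "Q = {(a, b), (a', b')}" and ne: "(a, b) \<noteq> (a', b')"
    by (auto simp: card_2_iff)
  have ab: "a < b" "b < n" "a \<noteq> u" "b \<noteq> u" "E a b" "a' < b'" "b' < n" "a' \<noteq> u" "b' \<noteq> u" "E a' b'"
    using Q by (auto simp: Q_def set_eq_iff)
  have rest: "E i j \<longleftrightarrow> (i, j) \<in> Q \<or> (j, i) \<in> Q" if "i \<noteq> u" "j \<noteq> u" for i j
    using that sym irr lt unfolding Q_def by (auto, metis linorder_neqE_nat)
  have Eu: "E u j \<longleftrightarrow> j < n \<and> j \<noteq> u" "E j u \<longleftrightarrow> j < n \<and> j \<noteq> u" for j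
    using dom sym irr lt by blast+
  have share: "a = a' \<or> a = b' \<or> b = a' \<or> b = b'"
  \<comment> \<open>For disjoint edges ab and a'b', the vertices a and a' have the common neighbour
    u, yet b is private to a and b' to a', against nesting.\<close>
  proof (rule ccontr)
    assume disj: "\<not> ?thesis"
    then have "\<not> E a b'" "\<not> E a' b" using ab by (auto simp: rest Q)
    then have "b \<in> private_nbrs E a a'" "b' \<in> private_nbrs E a' a"
      using disj ab by (auto simp: private_nbrs_def)
    moreover have "a \<noteq> a'" "E a u" "E a' u" using disj ab Eu by auto
    ultimately show False using nest unfolding nested_nbrs_def by blast
  qed
  \<comment> \<open>The hypothesis on Q forgets the orientation of its pairs, so that the four ways
    of sharing an endpoint p become instances.\<close>
  have path: "graph_iso n E (B1 n)"
    if pqr: "p < n" "q < n" "r < n" "distinct [u, p, q, r]"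
      and *: "\<And>i j. (i, j) \<in> Q \<or> (j, i) \<in> Q \<longleftrightarrow> (i = p \<and> (j = q \<or> j = r)) \<or> (j = p \<and> (i = q \<or> i = r))"
    for p q r
  proof -
    have "E i j \<longleftrightarrow> star_plus_path n u p q r i j" for i j
    proof (cases "i = u \<or> j = u")
      case True
      then show ?thesis using pqr u Eu by (auto simp: star_plus_path_def)
    next
      case False
      then show ?thesis
        using pqr rest[of i j] *[of i j] by (auto simp: star_plus_path_def)
    qed
    then have "E = star_plus_path n u p q r" by blast
    then show ?thesis using graph_iso_star_plus_path u pqr by simp
  qed
  from share ne consider "a = a'" "b \<noteq> b'" | "a = b'" | "b = a'" | "b = b'" "a \<noteq> a'" by auto
  then show ?thesis
  proof cases
    case 1
    then show ?thesis using ab by (intro path[of a b b']) (auto simp: Q)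
  next
    case 2
    then show ?thesis using ab by (intro path[of a b a']) (auto simp: Q)
  next
    case 3
    then show ?thesis using ab by (intro path[of b a b']) (auto simp: Q)
  next
    case 4
    then show ?thesis using ab by (intro path[of b a a']) (auto simp: Q)
  qed
qed

section \<open>The graph B_1 and the conclusion\<close>

lemma bicyclic_B1:
  assumes "4 \<le> n"
  shows "bicyclic n (B1 n)"
proof -
  have S: "simple_graph n (B1 n)" by (auto simp: simple_graph_def B1_def)
  have dom: "\<forall>w<n. w \<noteq> 0 \<longrightarrow> B1 n 0 w" using assms by (auto simp: B1_def)
  have "{(i, j). i < j \<and> j < n \<and> B1 n i j \<and> i \<noteq> 0 \<and> j \<noteq> 0} = {(1, 2), (1, 3)}"
    using assms by (auto simp: B1_def)
  then have "num_edges n (B1 n) = n + 1"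
    using num_edges_dominating[OF S _ dom] assms by simp
  moreover have "(B1 n)\<^sup>*\<^sup>* i j" if "i < n" "j < n" for i j
  proof -
    have "(B1 n)\<^sup>*\<^sup>* i 0"
      using that by (cases "i = 0") (auto simp: B1_def)
    moreover have "(B1 n)\<^sup>*\<^sup>* 0 j"
      using that by (cases "j = 0") (auto simp: B1_def)
    ultimately show ?thesis by (rule rtranclp_trans)
  qed
  ultimately show ?thesis using S by (simp add: bicyclic_def connected_graph_def)
qed

theorem theorem5p2:
  fixes f :: "real \<Rightarrow> real \<Rightarrow> real" and n :: nat and E :: "nat \<Rightarrow> nat \<Rightarrow> bool"
  assumes "property_P_star f"
    and "n \<ge> 6"
    and "bicyclic n E"
    and "\<not> graph_iso n E (B1 n)"
  shows "bicyclic n (B1 n) \<and> rho (A_f f n E) < rho (A_f f n (B1 n))"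
proof -
  have n: "0 < n" "4 \<le> n" using \<open>n \<ge> 6\<close> by auto
  have B1: "bicyclic n (B1 n)" using n by (intro bicyclic_B1)
  let ?S = "(\<lambda>F. rho (A_f f n F)) ` {F. bicyclic n F}"
  have fin: "finite ?S" using finite_bicyclic by simp
  then have "Max ?S \<in> ?S" using B1 by (intro Max_in) auto
  then obtain M where M: "bicyclic n M" and MS: "rho (A_f f n M) = Max ?S" by fastforce
  have max: "rho (A_f f n F) \<le> rho (A_f f n M)" if "bicyclic n F" for F
    unfolding MS using fin that by (intro Max_ge) auto
  have "nested_nbrs M"
    using exists_larger_rho[OF assms(1) M] max by (meson not_le)
  then have "graph_iso n M (B1 n)" by (rule bicyclic_nested_imp_iso_B1[OF M n(1)])
  then have "rho (A_f f n M) \<le> rho (A_f f n (B1 n))"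
    using M B1 n by (intro rho_le_of_graph_iso[OF assms(1)]) (auto simp: bicyclic_def)
  \<comment> \<open>Strictness: E itself admits an improving step to some F, whose value is at most
    that of the maximiser M and hence at most that of B_1.\<close>
  moreover have "\<not> nested_nbrs E"
    using bicyclic_nested_imp_iso_B1[OF assms(3) n(1)] assms(4) by blast
  then obtain F where "bicyclic n F" "rho (A_f f n E) < rho (A_f f n F)"
    using exists_larger_rho[OF assms(1,3)] by blast
  ultimately show ?thesis using B1 max[of F] by simp
qed

end
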